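(* Let $e\ge 2$, let $w\in\tilde{\mathfrak S}_e$ and for $c\in\mathbb Z$ let $\lambda^{(c)}:=w\cdot\emptyset_c$. Then for every $c\in\{1,\dots,e-1\}$, the $c$-charged $e$-core $\lambda^{(c)}$ is obtained from the $(c-1)$-charged $e$-core $\lambda^{(c-1)}$ as follows: 1) let $\mu_{c-1,c}$ be the $(c-1)$-charged partition obtained from $\lambda^{(c-1)}$ by adding the smallest rim hook (i.e. the one with the fewest nodes) with the following two properties: exactly one of its nodes lies in the first column strictly below the first column of the Young diagram of $\lambda^{(c-1)}$, and its hand has residue $w(c)-1 \pmod e$ (residues computed with charge $c-1$); 2) remove the first column of $\mu_{c-1,c}$.
   Context: A partition is a finite non-increasing sequence $\lambda=(\lambda_1\ge\dots\ge\lambda_h>0)$, $h\ge0$; a $c$-charged partition is a partition together with an integer $c$. Its Young diagram is $Y(\lambda)=\{(a,b)\in\mathbb Z^2: 1\le a\le h,\ 1\le b\le\lambda_a\}$ (rows indexed by $a$ going down, columns by $b$ going right). The residue of a node $(a,b)$ of a $c$-charged partition is $b-a+c \bmod e$. The abacus of a $c$-charged partition $\lambda$ is $\{\lambda_k-k+c+1: k\ge1\}\subseteq\mathbb Z$ (with $\lambda_k=0$ for $k>h$); any subset $A\subseteq\mathbb Z$ containing all sufficiently negative integers and no sufficiently large integers is the abacus of a unique charged partition. $\emptyset_c$ denotes the empty $c$-charged partition (abacus $\mathbb Z_{\le c}$). A charged partition with abacus $A$ is an $e$-core if $x\in A\Rightarrow x-e\in A$. The affine symmetric group $\tilde{\mathfrak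 S}_e$ is the group of bijections $w:\mathbb Z\to\mathbb Z$ with $w(i+e)=w(i)+e$ for all $i$ and $w(1)+\dots+w(e)=e(e+1)/2$; it is a Coxeter group with generators $s_0,\dots,s_{e-1}$, where $s_i$ swaps $i+ke$ and $i+1+ke$ for all $k\in\mathbb Z$. It acts on charged partitions by $w\cdot\lambda$ := the charged partition whose abacus is $w(A)$, $A$ the abacus of $\lambda$; this preserves the charge and the set of $e$-cores. For a partition $\lambda$ and a node $\gamma=(a,b)\in Y(\lambda)$, the rim hook $R^\lambda_\gamma=\{(x,y)\in Y(\lambda): x\ge a,\ y\ge b,\ (x+1,y+1)\notin Y(\lambda)\}$; its hand is the node $(a,y)\in R^\lambda_\gamma$ with $y$ maximal. Removing $R$ from $\lambda$ gives the partition with diagram $Y(\lambda)\setminus R$; $\lambda$ is obtained from that partition (same charge) by adding $R$. Removing the first column of a $(c-1)$-charged partition $(\mu_1,\dots,\mu_h)$ gives the $c$-charged partition $(\mu_1-1,\dots,\mu_h-1)$ with zero parts deleted. *)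

theory Defs
  imports Main
begin

definition is_partition :: "nat list \<Rightarrow> bool" where
  "is_partition p \<longleftrightarrow> sorted_wrt (\<ge>) p \<and> 0 \<notin> set p"

type_synonym charged = "nat list \<times> int"

definition charged_partition :: "charged \<Rightarrow> bool" where
  "charged_partition l \<longleftrightarrow> is_partition (fst l)"

abbreviation parts :: "charged \<Rightarrow> nat list" where "parts l \<equiv> fst l"

abbreviation charge :: "charged \<Rightarrow> int" where "charge l \<equiv> snd l"

definition part :: "charged \<Rightarrow> nat \<Rightarrow> nat" where
  "part l k = (if 1 \<le> k \<and> k \<le> length (parts l) then parts l ! (k - 1) else 0)"

definition young :: "charged \<Rightarrow> (int \<times> int) set" where
  "young l = {(a, b). 1 \<le> a \<and> a \<le> int (length (parts l)) \<and>
                      1 \<le> b \<and> b \<le> int (part l (nat a))}"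

definition node_residue :: "nat \<Rightarrow> int \<Rightarrow> int \<times> int \<Rightarrow> int" where
  "node_residue e c g = (snd g - fst g + c) mod int e"

definition abacus :: "charged \<Rightarrow> int set" where
  "abacus l = {int (part l k) - int k + charge l + 1 | k. k \<ge> 1}"

definition empty_charged :: "int \<Rightarrow> charged" where
  "empty_charged c = ([], c)"

definition is_core :: "nat \<Rightarrow> charged \<Rightarrow> bool" where
  "is_core e l \<longleftrightarrow> charged_partition l \<and> (\<forall>x. x \<in> abacus l \<longrightarrow> x - int e \<in> abacus l)"

definition affine_sym :: "nat \<Rightarrow> (int \<Rightarrow> int) set" where
  "affine_sym e = {w. bij w \<and> (\<forall>i. w (i + int e) = w i + int e) \<and>
                      (\<Sum>i = 1..int e. w i) = int e * (int e + 1) div 2}"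

text \<open>A set that is the abacus of a charged partition is the abacus of only one, and \<open>affine_sym e\<close>
  maps abaci to abaci; so the description denotes for \<open>w\<close> in \<open>affine_sym e\<close>.\<close>

definition act :: "(int \<Rightarrow> int) \<Rightarrow> charged \<Rightarrow> charged" where
  "act w l = (THE m. charged_partition m \<and> abacus m = w ` abacus l)"

definition rim_hook :: "charged \<Rightarrow> int \<times> int \<Rightarrow> (int \<times> int) set" where
  "rim_hook l g = {(x, y) \<in> young l. x \<ge> fst g \<and> y \<ge> snd g \<and> (x + 1, y + 1) \<notin> young l}"

definition hand :: "charged \<Rightarrow> int \<times> int \<Rightarrow> int \<times> int" where
  "hand l g = (fst g, Max {y. (fst g, y) \<in> rim_hook l g})"

text \<open>\<open>m\<close> is obtained from \<open>l\<close> by adding the rim hook \<open>rim_hook m g\<close>.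
  The added rim hook and the pair \<open>(m, g)\<close> determine each other.\<close>

definition adds_rim_hook :: "charged \<Rightarrow> charged \<times> (int \<times> int) \<Rightarrow> bool" where
  "adds_rim_hook l = (\<lambda>(m, g).
     charged_partition m \<and> charge m = charge l \<and> g \<in> young m \<and>
     young l = young m - rim_hook m g)"

definition below_first_column :: "charged \<Rightarrow> (int \<times> int) set" where
  "below_first_column l = {(x, y). y = 1 \<and> x > int (length (parts l))}"

definition admissible_hook :: "nat \<Rightarrow> int \<Rightarrow> charged \<Rightarrow> charged \<times> (int \<times> int) \<Rightarrow> bool" where
  "admissible_hook e i l = (\<lambda>(m, g).
     adds_rim_hook l (m, g) \<and>
     card (rim_hook m g \<inter> below_first_column l) = 1 \<and>
     node_residue e (charge l) (hand m g) = i mod int e)"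

definition smallest_admissible_hook ::
    "nat \<Rightarrow> int \<Rightarrow> charged \<Rightarrow> charged \<times> (int \<times> int) \<Rightarrow> bool" where
  "smallest_admissible_hook e i l =
     is_arg_min (\<lambda>(m, g). card (rim_hook m g)) (admissible_hook e i l)"

definition remove_first_column :: "charged \<Rightarrow> charged" where
  "remove_first_column m = (filter (\<lambda>k. k \<noteq> 0) (map (\<lambda>k. k - 1) (parts m)), charge m + 1)"

end

theory Submission
  imports Defs
begin

text \<open>Let \<open>A = w ` {..c - 1}\<close>, the abacus of \<open>act w (empty_charged (c - 1))\<close>; the abacus of \<open>act w (empty_charged c)\<close> is
  \<open>insert (w c) A\<close>. Adding a rim hook with exactly one node below the first column moves the bead just
  below the first gap of \<open>A\<close> to a position \<open>y \<notin> A\<close>, and removing the first column afterwards puts that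
  bead back, so the result has abacus \<open>insert y A\<close>. The hand has residue \<open>y - 1\<close> and the
  size of the hook is \<open>y\<close> plus a constant. Every position smaller than and congruent to \<open>w c\<close> is
  \<open>w (c - k * e)\<close> with \<open>k > 0\<close>, hence in \<open>A\<close>; so the smallest hook is the one with \<open>y = w c\<close>.\<close>

section \<open>Charged partitions and abaci\<close>

text \<open>The beta-number of row \<open>k\<close>, that is, the bead encoding this row. Empty rows
  count too, so the values at \<open>k \<ge> 1\<close> exhaust the abacus.\<close>

definition beta :: "charged \<Rightarrow> nat \<Rightarrow> int" where
  "beta l k = int (part l k) - int k + charge l + 1"

lemma abacus_eq_beta: "abacus l = beta l ` {1..}"
  by (auto simp: abacus_def beta_def image_def)

lemma part_eq_0: "length (parts l) < k \<Longrightarrow> part l k = 0"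
  by (simp add: part_def)

lemma part_pos:
  assumes "charged_partition l" "1 \<le> k" "k \<le> length (parts l)"
  shows "1 \<le> part l k"
proof -
  have "parts l ! (k - 1) \<in> set (parts l)"
    using assms by (intro nth_mem) auto
  then have "parts l ! (k - 1) \<noteq> 0"
    using assms(1) unfolding charged_partition_def is_partition_def by metis
  then show ?thesis
    using assms by (simp add: part_def)
qed

lemma part_antimono:
  assumes "charged_partition l" "1 \<le> j" "j \<le> k"
  shows "part l k \<le> part l j"
proof (cases "k \<le> length (parts l) \<and> j < k")
  case True
  then have "parts l ! (j - 1) \<ge> parts l ! (k - 1)"
    using assms unfolding charged_partition_def is_partition_def
    by (intro sorted_wrt_nth_less[of "(\<ge>)" "parts l" "j - 1" "k - 1"]) auto
  then show ?thesis
    using True assms by (simp add: part_def)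
next
  case False
  then show ?thesis
    using assms by (cases "j = k") (auto simp: part_eq_0)
qed

lemma charged_partition_eqI:
  assumes "charged_partition l" "charged_partition m" "charge l = charge m"
    and eq: "\<And>k. 1 \<le> k \<Longrightarrow> part l k = part m k"
  shows "l = m"
proof -
  have le: "length (parts l') \<le> length (parts m')"
    if "charged_partition l'" "\<And>k. 1 \<le> k \<Longrightarrow> part l' k = part m' k" for l' m'
  proof (rule ccontr)
    assume "\<not> ?thesis"
    then show False
      using part_pos[OF that(1), of "length (parts l')"] that(2)[of "length (parts l')"]
      by (simp add: part_eq_0)
  qed
  have len: "length (parts l) = length (parts m)"
    using le[of l m] le[of m l] assms by force
  have "parts l = parts m"
  proof (rule nth_equalityI[OF len])
    fix i assume "i < length (parts l)"
    then show "parts l ! i = parts m ! i"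
      using eq[of "Suc i"] len by (simp add: part_def)
  qed
  then show ?thesis
    using assms(3) by (simp add: prod_eq_iff)
qed

lemma charged_partition_of_fun:
  fixes q :: "nat \<Rightarrow> nat"
  assumes anti: "\<And>j k. 1 \<le> j \<Longrightarrow> j \<le> k \<Longrightarrow> q k \<le> q j"
    and pos: "\<And>k. 1 \<le> k \<Longrightarrow> (1 \<le> q k \<longleftrightarrow> k \<le> n)"
  obtains m where "charged_partition m" "charge m = d" "length (parts m) = n"
    "\<And>k. 1 \<le> k \<Longrightarrow> part m k = q k"
proof
  let ?m = "(map q [1..<Suc n], d)"
  have "sorted_wrt (\<ge>) (map q [1..<Suc n])"
    by (auto simp: sorted_wrt_iff_nth_less intro!: anti simp del: upt_Suc)
  moreover have "0 \<notin> set (map q [1..<Suc n])"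
    using pos by fastforce
  ultimately show "charged_partition ?m"
    by (simp add: charged_partition_def is_partition_def)
  show "part ?m k = q k" if "1 \<le> k" for k
    using that pos[of k] by (auto simp: part_def simp del: upt_Suc)
qed auto

lemma beta_strict_antimono:
  assumes "charged_partition l" "1 \<le> j" "j < k"
  shows "beta l k < beta l j"
  using part_antimono[OF assms(1,2), of k] assms(3) by (simp add: beta_def)

text \<open>Beta-numbers decrease strictly, and a decreasing sequence is determined by its range.
  This makes the description in \<open>act\<close> unambiguous.\<close>

lemma abacus_inj:
  assumes l: "charged_partition l" and m: "charged_partition m" and eq: "abacus l = abacus m"
  shows "l = m"
proof -
  \<comment> \<open>If the sequences agree before \<open>k\<close>, the bead
    \<open>beta l' k\<close> cannot occur in \<open>m'\<close> before index \<open>k\<close>; so it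
    is at most \<open>beta m' k\<close>.\<close>
  have step: "beta l' k \<le> beta m' k"
    if l': "charged_partition l'" and m': "charged_partition m'" and "abacus l' = abacus m'"
      and k: "1 \<le> k" and less: "\<And>j. j < k \<Longrightarrow> 1 \<le> j \<Longrightarrow> beta l' j = beta m' j" for l' m' k
  proof -
    have "beta l' k \<in> abacus m'"
      using that by (metis abacus_eq_beta atLeast_iff imageI)
    then obtain j where j: "1 \<le> j" "beta l' k = beta m' j"
      by (auto simp: abacus_eq_beta)
    have "\<not> j < k"
      using less[of j] j beta_strict_antimono[OF l' j(1), of k] by auto
    then show ?thesis
      using beta_strict_antimono[OF m' k, of j] j by (cases "j = k") auto
  qed
  have beta_eq: "beta l k = beta m k" if "1 \<le> k" for k
    using that
  proof (induction k rule: less_induct)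
    case (less k)
    then show ?case
      using step[OF l m eq] step[OF m l eq[symmetric]] by (metis order_antisym)
  qed
  \<comment> \<open>Row \<open>n\<close> is empty in both partitions, so its beta-number reveals the
    charge.\<close>
  define n where "n = Suc (length (parts l) + length (parts m))"
  have "charge l = charge m"
    using beta_eq[of n] by (simp add: beta_def part_eq_0 n_def)
  then show ?thesis
    using l m beta_eq by (intro charged_partition_eqI) (auto simp: beta_def)
qed

section \<open>Maya diagrams and their charge\<close>

text \<open>No rows are mentioned here, so the charge of an image under \<open>w\<close> can be
  found by counting elements above a cut-off \<open>M\<close>.\<close>

definition maya_charge :: "int set \<Rightarrow> int \<Rightarrow> bool" where
  "maya_charge S d \<longleftrightarrow> (\<exists>F M. finite F \<and> F \<subseteq> {M<..} \<and> S = F \<union> {..M} \<and> d = M + int (card F))"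

lemma image_Suc_atLeast_nat: "Suc ` {n..} = {Suc n..}"
proof (intro equalityI subsetI)
  fix x assume "x \<in> {Suc n..}"
  then show "x \<in> Suc ` {n..}"
    by (intro image_eqI[of _ _ "x - 1"]) auto
qed auto

lemma maya_charge_insert:
  assumes "maya_charge S d" "x \<notin> S"
  shows "maya_charge (insert x S) (d + 1)"
proof -
  obtain F M where F: "finite F" "F \<subseteq> {M<..}" "S = F \<union> {..M}" "d = M + int (card F)"
    using assms(1) unfolding maya_charge_def by blast
  then have "finite (insert x F)" "insert x F \<subseteq> {M<..}" "insert x S = insert x F \<union> {..M}"
    "d + 1 = M + int (card (insert x F))"
    using assms(2) by auto
  then show ?thesis
    unfolding maya_charge_def by blast
qed

text \<open>A bead above all others becomes a new first row. The old rows move down by one index,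
  which raising the charge by one compensates.\<close>

lemma charged_partition_abacus_insert:
  assumes l: "charged_partition l" and y: "\<And>x. x \<in> abacus l \<Longrightarrow> x < y"
  shows "\<exists>m. charged_partition m \<and> charge m = charge l + 1 \<and> abacus m = insert y (abacus l)"
proof -
  \<comment> \<open>The solution of \<open>beta m 1 = y\<close> for the first row of a partition
    \<open>m\<close> of charge \<open>charge l + 1\<close>.\<close>
  define t where "t = nat (y - charge l - 1)"
  define q where "q k = (if k = 1 then t else part l (k - 1))" for k
  \<comment> \<open>If \<open>t = 0\<close>, then \<open>l\<close> is empty as well, and the new row
    contributes no part.\<close>
  define n where "n = (if t = 0 then 0 else Suc (length (parts l)))"
  have "beta l 1 < y"
    by (rule y) (simp add: abacus_eq_beta)
  then have t: "int t = y - charge l - 1" "part l 1 \<le> t"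
    by (auto simp: t_def beta_def)
  have "q k \<le> q j" if "1 \<le> j" "j \<le> k" for j k
  proof (cases "j = 1 \<and> k \<noteq> 1")
    case True
    then have "part l (k - 1) \<le> part l 1"
      using that by (intro part_antimono[OF l]) auto
    then show ?thesis
      using True t(2) by (simp add: q_def)
  next
    case False
    then show ?thesis
      using that part_antimono[OF l, of "j - 1" "k - 1"] by (auto simp: q_def)
  qed
  moreover have "1 \<le> q k \<longleftrightarrow> k \<le> n" if "1 \<le> k" for k
  proof (cases "k = 1")
    case False
    then have k: "1 \<le> k - 1"
      using that by simp
    then show ?thesis
      using part_pos[OF l k] part_eq_0[of l "k - 1"] part_antimono[OF l _ k] t(2)
      by (cases "k - 1 \<le> length (parts l)") (auto simp: q_def n_def)
  qed (auto simp: q_def n_def)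
  ultimately obtain m where m: "charged_partition m" "charge m = charge l + 1"
    "\<And>k. 1 \<le> k \<Longrightarrow> part m k = q k"
    using charged_partition_of_fun[of q n "charge l + 1"] by metis
  have "beta m 1 = y"
    using m t by (simp add: beta_def q_def)
  moreover have "beta m (Suc k) = beta l k" if "1 \<le> k" for k
    using m that by (simp add: beta_def q_def)
  moreover have "{1..} = insert 1 (Suc ` {1..})"
    by (auto simp: image_Suc_atLeast_nat)
  ultimately have "abacus m = insert y (abacus l)"
    by (metis (no_types, lifting) abacus_eq_beta atLeast_iff image_cong image_image image_insert)
  then show ?thesis
    using m by blast
qed

text \<open>Starting from the empty partition of charge \<open>M\<close>, the elements of
  \<open>F\<close> are inserted in increasing order, each as a new first row.\<close>

lemma maya_charge_abacus:
  assumes "maya_charge S d"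
  shows "\<exists>l. charged_partition l \<and> charge l = d \<and> abacus l = S"
proof -
  obtain F M where F: "finite F" "F \<subseteq> {M<..}" "S = F \<union> {..M}" "d = M + int (card F)"
    using assms unfolding maya_charge_def by blast
  have "\<exists>l. charged_partition l \<and> charge l = M + int (card F) \<and> abacus l = F \<union> {..M}"
    using F(1,2)
  proof (induction F rule: finite_linorder_max_induct)
    case empty
    have "abacus ([], M) = {..M}"
    proof (intro equalityI subsetI)
      fix x assume "x \<in> {..M}"
      then have "x = beta ([], M) (nat (M + 1 - x))" "1 \<le> nat (M + 1 - x)"
        by (auto simp: beta_def part_def)
      then show "x \<in> abacus ([], M)"
        unfolding abacus_eq_beta by blast
    qed (auto simp: abacus_eq_beta beta_def part_def)
    then show ?case
      by (intro exI[of _ "([], M)"]) (simp add: charged_partition_def is_partition_def)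
  next
    case (insert y F)
    then obtain l where l: "charged_partition l" "charge l = M + int (card F)"
      "abacus l = F \<union> {..M}"
      by auto
    have "\<exists>m. charged_partition m \<and> charge m = charge l + 1 \<and> abacus m = insert y (abacus l)"
      using insert l by (intro charged_partition_abacus_insert) auto
    then obtain m where "charged_partition m" "charge m = charge l + 1"
      "abacus m = insert y (abacus l)"
      by blast
    moreover have "y \<notin> F"
      using insert.hyps by blast
    ultimately show ?case
      using insert.hyps l by (intro exI[of _ m]) auto
  qed
  then show ?thesis
    using F by simp
qed

section \<open>The affine symmetric group\<close>

lemma affine_sym_shift:
  assumes "w \<in> affine_sym e"
  shows "w (i + int e * k) = w i + int e * k"
proof -
  have w: "w (j + int e) = w j + int e" for j
    using assms by (simp add: affine_sym_def)
  have nat_case: "w (j + int e * int n) = w j + int e * int n" for j n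
  proof (induction n)
    case (Suc n)
    then show ?case
      using w[of "j + int e * int n"] by (simp add: algebra_simps)
  qed simp
  show ?thesis
  proof (cases "0 \<le> k")
    case True
    then show ?thesis
      using nat_case[of i "nat k"] by simp
  next
    \<comment> \<open>For negative \<open>k\<close>, the shift by \<open>- k\<close> is applied to
      \<open>i + int e * k\<close>.\<close>
    case False
    then show ?thesis
      using nat_case[of "i + int e * k" "nat (- k)"] by simp
  qed
qed

text \<open>The image splits into \<open>E\<close> progressions \<open>w i - E * j\<close> with
  \<open>j \<ge> 1\<close>. Progression \<open>i\<close> has \<open>q i + N\<close> elements above
  the cut-off \<open>- (E * N)\<close>, and all positions up to the cut-off are filled. The
  normalization of the sum of \<open>w\<close> forces the \<open>q i\<close> to add up to 0, hence
  charge 0.\<close>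

lemma affine_sym_maya_charge_0:
  assumes e: "1 \<le> e" and w: "w \<in> affine_sym e"
  shows "maya_charge (w ` {..0}) 0"
proof -
  define E where "E = int e"
  have E: "0 < E"
    using e by (simp add: E_def)
  have inj: "inj w" and surj: "surj w"
    using w by (auto simp: affine_sym_def bij_def)
  have shift: "w (i + E * k) = w i + E * k" for i k
    using affine_sym_shift[OF w] by (simp add: E_def)
  have sum_w: "(\<Sum>i = 1..E. w i) = E * (E + 1) div 2"
    using w by (simp add: affine_sym_def E_def)
  \<comment> \<open>Large enough that every \<open>w i\<close> with \<open>i\<close> in
    \<open>{1..E}\<close> lies above the cut-off \<open>- (E * N)\<close>.\<close>
  define N where "N = (\<Sum>i = 1..E. \<bar>w i\<bar>) + 1"
  have N: "0 < w i + E * N" if "i \<in> {1..E}" for i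
  proof -
    have "\<bar>w i\<bar> \<le> (\<Sum>i = 1..E. \<bar>w i\<bar>)"
      using that by (intro member_le_sum) auto
    then have "\<bar>w i\<bar> < N"
      by (simp add: N_def)
    moreover have "1 * N \<le> E * N"
      using E by (intro mult_right_mono) (auto simp: N_def intro: add_nonneg_nonneg sum_nonneg)
    ultimately show ?thesis
      by linarith
  qed
  \<comment> \<open>Subtracting 1 matches the representatives \<open>{1..E}\<close> with the
    remainders \<open>{0..<E}\<close>.\<close>
  define q where "q i = (w i - 1) div E" for i
  define B where "B i = (\<lambda>j. w i - E * j) ` {1..q i + N}" for i
  define F where "F = (\<Union>i\<in>{1..E}. B i)"
  have le_q: "j \<le> q i + N \<longleftrightarrow> - (E * N) < w i - E * j" for i j
  proof -
    have "j - N \<le> (w i - 1) div E \<longleftrightarrow> E * (j - N) \<le> w i - 1"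
    proof
      assume "j - N \<le> (w i - 1) div E"
      then have "E * (j - N) \<le> E * ((w i - 1) div E)"
        using E by (intro mult_left_mono) auto
      then show "E * (j - N) \<le> w i - 1"
        using E mult_div_mod_eq[of E "w i - 1"] pos_mod_sign[of E "w i - 1"] by linarith
    next
      assume "E * (j - N) \<le> w i - 1"
      then show "j - N \<le> (w i - 1) div E"
        using E zdiv_mono1[of "E * (j - N)" "w i - 1" E] by simp
    qed
    then show ?thesis
      by (auto simp: q_def algebra_simps)
  qed
  have w_repr: "\<exists>i\<in>{1..E}. \<exists>j. n = i - E * j \<and> (n \<le> 0 \<longrightarrow> 1 \<le> j)" for n
  proof -
    define i where "i = (n - 1) mod E + 1"
    define j where "j = - ((n - 1) div E)"
    have "n = i - E * j"
      using mult_div_mod_eq[of E "n - 1"] by (simp add: i_def j_def)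
    moreover have "i \<in> {1..E}"
      using E pos_mod_sign[of E "n - 1"] pos_mod_bound[of E "n - 1"]
      unfolding i_def atLeastAtMost_iff by linarith
    moreover have "1 \<le> j" if "n \<le> 0"
      using that E pos_imp_zdiv_neg_iff[of E "n - 1"] by (auto simp: j_def)
    ultimately show ?thesis
      by blast
  qed
  have w_le: "w (i - E * j) = w i - E * j" for i j
    using shift[of i "- j"] by simp
  have "w ` {..0} = F \<union> {..- (E * N)}"
  proof (intro equalityI subsetI)
    fix x assume "x \<in> w ` {..0}"
    then obtain n where "x = w n" "n \<le> 0"
      by auto
    with w_repr obtain i j where ij: "i \<in> {1..E}" "1 \<le> j" "x = w i - E * j"
      by (metis w_le)
    show "x \<in> F \<union> {..- (E * N)}"
    proof (cases "j \<le> q i + N")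
      case True
      then have "x \<in> B i"
        using ij by (simp add: B_def)
      then show ?thesis
        using ij(1) by (auto simp: F_def)
    next
      case False
      then show ?thesis
        using ij le_q by auto
    qed
  next
    fix x assume x: "x \<in> F \<union> {..- (E * N)}"
    have "\<exists>i\<in>{1..E}. \<exists>j\<ge>1. x = w i - E * j"
    proof (cases "x \<in> F")
      case True
      then obtain i where "i \<in> {1..E}" "x \<in> B i"
        by (auto simp: F_def)
      then show ?thesis
        unfolding B_def by (intro bexI[of _ i]) auto
    next
      case False
      \<comment> \<open>Surjectivity puts \<open>x\<close> on some progression; since
        \<open>x\<close> is at or below the cut-off and \<open>w i\<close> is above it,
        \<open>j\<close> must be positive.\<close>
      obtain n where "x = w n"
        using surj by blast
      then obtain i j where ij: "i \<in> {1..E}" "x = w i - E * j"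
        using w_repr[of n] w_le by metis
      then have "0 < E * j"
        using N[of i] False x by auto
      then have "1 \<le> j"
        using E by (simp add: zero_less_mult_iff)
      then show ?thesis
        using ij by blast
    qed
    then obtain i j where ij: "i \<in> {1..E}" "1 \<le> j" "x = w (i - E * j)"
      using w_le by metis
    have "E * 1 \<le> E * j"
      using E ij by (intro mult_left_mono) auto
    then have "i - E * j \<le> 0"
      using ij(1) unfolding atLeastAtMost_iff by linarith
    then show "x \<in> w ` {..0}"
      using ij by blast
  qed
  moreover have "finite F"
    by (simp add: F_def B_def)
  moreover have "F \<subseteq> {- (E * N)<..}"
    using le_q by (auto simp: F_def B_def)
  moreover have "int (card F) = E * N"
  proof -
    \<comment> \<open>A congruence between \<open>w i\<close> and \<open>w i'\<close> pulls back
      along \<open>w\<close> by periodicity and injectivity.\<close>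
    have cong: "i = i'" if ii': "i \<in> {1..E}" "i' \<in> {1..E}" "E dvd w i - w i'" for i i'
    proof -
      obtain k where "w i - w i' = E * k"
        using ii'(3) by blast
      then have "w i = w (i' + E * k)"
        by (simp add: shift)
      then have "i = i' + E * k"
        using inj by (simp add: inj_eq)
      then have "E dvd i - i'"
        by simp
      moreover have "\<bar>i - i'\<bar> < E"
        using ii' by auto
      ultimately show ?thesis
        using dvd_imp_le_int[of "i - i'" E] by force
    qed
    have card_B: "int (card (B i)) = q i + N" if "i \<in> {1..E}" for i
    proof -
      have "0 \<le> q i + N"
        using le_q[of 0 i] N[OF that] by simp
      moreover have "inj_on (\<lambda>j. w i - E * j) {1..q i + N}"
        using E by (auto simp: inj_on_def)
      ultimately show ?thesis
        by (simp add: B_def card_image)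
    qed
    have "B i \<inter> B i' = {}" if "i \<in> {1..E}" "i' \<in> {1..E}" "i \<noteq> i'" for i i'
    proof (rule ccontr)
      assume "\<not> ?thesis"
      then obtain j j' where "w i - E * j = w i' - E * j'"
        by (auto simp: B_def)
      then have "w i - w i' = E * (j - j')"
        by (simp add: algebra_simps)
      then show False
        using cong[OF that(1,2)] that(3) by auto
    qed
    then have "card F = (\<Sum>i\<in>{1..E}. card (B i))"
      unfolding F_def by (intro card_UN_disjoint) (auto simp: B_def)
    then have card_F: "int (card F) = (\<Sum>i\<in>{1..E}. q i) + E * N"
      using E card_B by (simp add: sum.distrib)
    have "inj_on (\<lambda>i. (w i - 1) mod E) {1..E}"
      using cong by (auto intro!: inj_onI simp: mod_eq_dvd_iff)
    moreover have "(\<lambda>i. (w i - 1) mod E) ` {1..E} \<subseteq> {0..<E}"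
      using E by auto
    ultimately have bij: "bij_betw (\<lambda>i. (w i - 1) mod E) {1..E} {0..<E}"
      unfolding bij_betw_def by (simp add: card_image card_subset_eq)
    have Gauss: "(\<Sum>i = 1..int n. i) = int n * (int n + 1) div 2" for n
    proof (induction n)
      case (Suc n)
      have "{1..int (Suc n)} = insert (int (Suc n)) {1..int n}"
        by auto
      then show ?case
        using Suc by (simp add: algebra_simps)
    qed simp
    \<comment> \<open>The remainders of the \<open>w i - 1\<close> permute \<open>{0..<E}\<close>,
      so their sum is that of the \<open>i - 1\<close>, which by the normalization is that of the
      \<open>w i - 1\<close>. Nothing is left for the quotients.\<close>
    have "(\<Sum>i\<in>{1..E}. (w i - 1) mod E) = (\<Sum>i\<in>{0..<E}. i)"
      by (rule sum.reindex_bij_betw[OF bij])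
    also have "\<dots> = (\<Sum>i\<in>{1..E}. i - 1)"
      by (rule sum.reindex_bij_witness[of _ "\<lambda>i. i - 1" "\<lambda>i. i + 1"]) auto
    also have "\<dots> = (\<Sum>i\<in>{1..E}. w i - 1)"
      using Gauss[of e] sum_w by (simp add: sum_subtractf E_def)
    also have "\<dots> = (\<Sum>i\<in>{1..E}. E * q i + (w i - 1) mod E)"
      by (simp add: q_def)
    finally have "E * (\<Sum>i\<in>{1..E}. q i) = 0"
      by (simp add: sum.distrib sum_distrib_left)
    then show ?thesis
      using E card_F by simp
  qed
  ultimately show ?thesis
    unfolding maya_charge_def by (intro exI[of _ F] exI[of _ "- (E * N)"]) simp
qed

text \<open>From charge 0 upwards, each step adds the single bead \<open>w (int n + 1)\<close>, new
  by injectivity.\<close>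

lemma affine_sym_maya_charge:
  assumes "1 \<le> e" "w \<in> affine_sym e"
  shows "maya_charge (w ` {..int n}) (int n)"
proof (induction n)
  case 0
  then show ?case
    using affine_sym_maya_charge_0[OF assms] by simp
next
  case (Suc n)
  have "inj w"
    using assms(2) by (simp add: affine_sym_def bij_def)
  then have "w (int n + 1) \<notin> w ` {..int n}"
    by (auto simp: inj_eq)
  moreover have "{..int (Suc n)} = insert (int n + 1) {..int n}"
    by auto
  ultimately show ?case
    using maya_charge_insert[OF Suc] by (simp add: add.commute)
qed

section \<open>The action on empty charged partitions\<close>

lemma act_eqI:
  assumes "charged_partition m" "abacus m = w ` abacus l"
  shows "act w l = m"
  unfolding act_def using assms by (intro the_equality) (auto intro: abacus_inj)

lemma abacus_empty_charged: "abacus (empty_charged c) = {..c}"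
proof (intro equalityI subsetI)
  fix x assume "x \<in> {..c}"
  then have "x = beta (empty_charged c) (nat (c + 1 - x))" "1 \<le> nat (c + 1 - x)"
    by (auto simp: beta_def part_def empty_charged_def)
  then show "x \<in> abacus (empty_charged c)"
    unfolding abacus_eq_beta by blast
qed (auto simp: abacus_eq_beta beta_def part_def empty_charged_def)

lemma act_empty_charged:
  assumes "1 \<le> e" "w \<in> affine_sym e" "0 \<le> c"
  shows "charged_partition (act w (empty_charged c))" "charge (act w (empty_charged c)) = c"
    "abacus (act w (empty_charged c)) = w ` {..c}"
proof -
  obtain m where m: "charged_partition m" "charge m = c" "abacus m = w ` {..c}"
    using maya_charge_abacus[OF affine_sym_maya_charge[OF assms(1,2), of "nat c"]] assms(3)
    by auto
  then have "act w (empty_charged c) = m"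
    by (intro act_eqI) (simp_all add: abacus_empty_charged)
  then show "charged_partition (act w (empty_charged c))" "charge (act w (empty_charged c)) = c"
    "abacus (act w (empty_charged c)) = w ` {..c}"
    using m by simp_all
qed

text \<open>Subtracting \<open>int e\<close> commutes with \<open>w\<close> and maps
  \<open>{..c}\<close> into itself.\<close>

lemma is_core_act_empty_charged:
  assumes "1 \<le> e" "w \<in> affine_sym e" "0 \<le> c"
  shows "is_core e (act w (empty_charged c))"
proof -
  have "w i - int e = w (i - int e)" for i
    using affine_sym_shift[OF assms(2), of i "- 1"] by simp
  then show ?thesis
    using act_empty_charged[OF assms] by (auto simp: is_core_def)
qed

section \<open>Rim hooks with one node below the first column\<close>

text \<open>Here \<open>y\<close> is the abacus position of the row of \<open>m\<close> containing the hand; below that row, \<open>m\<close> is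
  \<open>l\<close> moved by one node along the diagonal.\<close>

definition hook_at :: "charged \<Rightarrow> int \<Rightarrow> charged \<times> (int \<times> int) \<Rightarrow> bool" where
  "hook_at l y = (\<lambda>(m, g). charged_partition m \<and> charge m = charge l \<and>
     length (parts m) = Suc (length (parts l)) \<and>
     (\<exists>a. 1 \<le> a \<and> a \<le> length (parts m) \<and> g = (int a, 1) \<and> beta m a = y \<and>
       (\<forall>x. 1 \<le> x \<and> x < a \<longrightarrow> part m x = part l x) \<and>
       (\<forall>x\<ge>a. part l x = part m (Suc x) - 1)))"

lemma hook_atE:
  assumes "hook_at l y (m, g)"
  obtains a where "charged_partition m" "charge m = charge l"
    "length (parts m) = Suc (length (parts l))" "1 \<le> a" "a \<le> length (parts m)"
    "g = (int a, 1)" "beta m a = y" "\<And>x. 1 \<le> x \<Longrightarrow> x < a \<Longrightarrow> part m x = part l x"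
    "\<And>x. a \<le> x \<Longrightarrow> part l x = part m (Suc x) - 1"
  using assms unfolding hook_at_def by auto

lemma mem_young: "(int x, int y) \<in> young l \<longleftrightarrow> 1 \<le> x \<and> 1 \<le> y \<and> y \<le> part l x"
  by (auto simp: young_def part_def)

lemma young_imp_nat: "(u, v) \<in> young l \<Longrightarrow> \<exists>x y. u = int x \<and> v = int y"
  by (rule exI[of _ "nat u"], rule exI[of _ "nat v"]) (simp add: young_def)

lemma below_first_column_imp_nat:
  "p \<in> below_first_column l \<Longrightarrow> \<exists>x. p = (int x, int 1) \<and> length (parts l) < x"
  by (rule exI[of _ "nat (fst p)"]) (auto simp: below_first_column_def)

text \<open>The last conjunct says that the diagonal successor of the node lies outside the
  diagram.\<close>

lemma mem_rim_hook:
  "(int x, int y) \<in> rim_hook l (int a, int b) \<longleftrightarrow>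
     1 \<le> x \<and> 1 \<le> y \<and> y \<le> part l x \<and> a \<le> x \<and> b \<le> y \<and> part l (Suc x) \<le> y"
  using mem_young[of "Suc x" "Suc y" l] by (auto simp: rim_hook_def mem_young add.commute)

lemma rim_hook_subset: "rim_hook l g \<subseteq> young l"
  by (auto simp: rim_hook_def)

text \<open>In each row \<open>x \<ge> a\<close> of \<open>m\<close> the hook occupies the columns
  from \<open>part m (Suc x)\<close> on, so removing it leaves \<open>part m (Suc x) - 1\<close>
  nodes, the row of \<open>l\<close>. Only the last row of \<open>m\<close> lies below
  \<open>l\<close>.\<close>

lemma hook_at_adds_rim_hook:
  assumes l: "charged_partition l" and hook: "hook_at l y (m, g)"
  shows "adds_rim_hook l (m, g)" "card (rim_hook m g \<inter> below_first_column l) = 1"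
proof -
  obtain a where m: "charged_partition m" "charge m = charge l"
    "length (parts m) = Suc (length (parts l))" and a: "1 \<le> a" "a \<le> length (parts m)"
    "g = (int a, 1)" "beta m a = y" and lt: "\<And>x. 1 \<le> x \<Longrightarrow> x < a \<Longrightarrow> part m x = part l x"
    and ge: "\<And>x. a \<le> x \<Longrightarrow> part l x = part m (Suc x) - 1"
    using hook_atE[OF hook] by metis
  have g: "g = (int a, int 1)"
    using a by simp
  have "g \<in> young m"
    unfolding g mem_young using part_pos[OF m(1) a(1,2)] a by simp
  moreover have "(u, v) \<in> young l \<longleftrightarrow> (u, v) \<in> young m - rim_hook m g" for u v
  proof (cases "\<exists>x y. u = int x \<and> v = int y")
    case True
    then obtain x y where uv: "u = int x" "v = int y"
      by blast
    have "part m (Suc x) \<le> part m x" if "1 \<le> x"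
      using part_antimono[OF m(1) that] by simp
    then show ?thesis
      unfolding uv g Diff_iff mem_young mem_rim_hook using lt[of x] ge[of x]
      by (cases "a \<le> x") auto
  next
    case False
    then show ?thesis
      using young_imp_nat by blast
  qed
  then have "young l = young m - rim_hook m g"
    by auto
  ultimately show "adds_rim_hook l (m, g)"
    using m by (simp add: adds_rim_hook_def)
  have "rim_hook m g \<inter> below_first_column l = {(int (length (parts m)), 1)}"
  proof (intro equalityI subsetI)
    fix p assume p: "p \<in> rim_hook m g \<inter> below_first_column l"
    then obtain x where x: "p = (int x, int 1)" "length (parts l) < x"
      using below_first_column_imp_nat by blast
    then have "1 \<le> part m x"
      using p mem_rim_hook[of x 1 m a 1] x by (simp add: g)
    then have "x \<le> length (parts m)"
      using part_eq_0[of m x] by force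
    then show "p \<in> {(int (length (parts m)), 1)}"
      using x m by simp
  next
    fix p assume "p \<in> {(int (length (parts m)), 1::int)}"
    then have p: "p = (int (length (parts m)), int 1)"
      by simp
    have "p \<in> rim_hook m g"
      unfolding p g mem_rim_hook using a m(3) part_pos[OF m(1), of "length (parts m)"]
      by (simp add: part_eq_0)
    moreover have "p \<in> below_first_column l"
      using m by (simp add: p below_first_column_def)
    ultimately show "p \<in> rim_hook m g \<inter> below_first_column l"
      by blast
  qed
  then show "card (rim_hook m g \<inter> below_first_column l) = 1"
    by simp
qed

text \<open>A hook node in the first column forces \<open>b = 1\<close>, and comparing row lengths
  gives the two formulas for the rows. Below \<open>l\<close> the hook meets the first column in
  every row from \<open>a\<close> to the last of \<open>m\<close>, so having one such node bounds
  the number of new rows.\<close>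

lemma adds_rim_hook_hook_at:
  assumes l: "charged_partition l" and adds: "adds_rim_hook l (m, g)"
    and card: "card (rim_hook m g \<inter> below_first_column l) = 1"
  shows "\<exists>y. hook_at l y (m, g)"
proof -
  have m: "charged_partition m" "charge m = charge l" and g_in: "g \<in> young m"
    and young: "young l = young m - rim_hook m g"
    using adds by (auto simp: adds_rim_hook_def)
  let ?h = "length (parts l)"
  obtain a b where g: "g = (int a, int b)"
    using g_in young_imp_nat by (metis surj_pair)
  have ab: "1 \<le> a" "1 \<le> b" "b \<le> part m a"
    using g_in unfolding g mem_young by auto
  obtain p where p: "rim_hook m g \<inter> below_first_column l = {p}"
    using card card_1_singletonE by blast
  then obtain z where z: "p = (int z, int 1)" "?h < z"
    using below_first_column_imp_nat by blast
  have z_in: "(int z, int 1) \<in> rim_hook m (int a, int b)"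
    using p z g by auto
  then have b: "b = 1" and az: "a \<le> z"
    using ab unfolding mem_rim_hook by auto
  have row: "1 \<le> v \<and> v \<le> part l x \<longleftrightarrow>
      1 \<le> v \<and> v \<le> part m x \<and> \<not> (a \<le> x \<and> part m (Suc x) \<le> v)" if "1 \<le> x" for x v
  proof -
    have "(int x, int v) \<in> young l \<longleftrightarrow> (int x, int v) \<in> young m - rim_hook m g"
      using young by simp
    then show ?thesis
      unfolding g Diff_iff mem_young mem_rim_hook b using that by auto
  qed
  have lt: "part m x = part l x" if "1 \<le> x" "x < a" for x
    using row[OF that(1), of "part m x"] row[OF that(1), of "part l x"] that by force
  have ge: "part l x = part m (Suc x) - 1" if "a \<le> x" for x
  proof -
    have x: "1 \<le> x"
      using ab that by simp
    have "part m (Suc x) \<le> part m x"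
      using part_antimono[OF m(1) x] by simp
    then show ?thesis
      using row[OF x, of "part l x"] row[OF x, of "part m (Suc x) - 1"] that by force
  qed
  have mem: "(int x, int 1) \<in> rim_hook m g \<longleftrightarrow> a \<le> x \<and> x \<le> length (parts m)" if "?h < x" for x
  proof -
    have "part m (Suc x) \<le> 1" if "a \<le> x"
      using ge[OF that] part_eq_0[OF \<open>?h < x\<close>] by simp
    moreover have "1 \<le> x"
      using that by simp
    ultimately show ?thesis
      using part_pos[OF m(1), of x] part_eq_0[of m x] unfolding g b mem_rim_hook by force
  qed
  have uniq: "x = z" if "?h < x" "a \<le> x" "x \<le> length (parts m)" for x
  proof -
    have "(int x, int 1) \<in> rim_hook m g \<inter> below_first_column l"
      using that mem[of x] by (simp add: below_first_column_def)
    then show ?thesis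
      using p z by simp
  qed
  have z_le: "z \<le> length (parts m)"
    using mem[OF z(2)] z_in g b by simp
  have len_m: "length (parts m) = z"
    using uniq[of "length (parts m)"] z z_le az by simp
  \<comment> \<open>Otherwise row \<open>z - 1\<close> would give a second hook node below the first
    column.\<close>
  have "\<not> a < z \<or> z = Suc ?h"
    using uniq[of "z - 1"] z z_le by fastforce
  \<comment> \<open>Rows above \<open>a\<close> are those of \<open>l\<close>; a gap between
    \<open>?h\<close> and \<open>a\<close> would be an empty row of \<open>m\<close> above a
    nonempty one.\<close>
  moreover have "z = Suc ?h" if "a = z"
  proof (rule ccontr)
    assume "z \<noteq> Suc ?h"
    then have "part m (Suc ?h) = 0"
      using lt[of "Suc ?h"] z that by (simp add: part_eq_0)
    then show False
      using part_pos[OF m(1), of "Suc ?h"] z z_le by simp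
  qed
  ultimately have "z = Suc ?h"
    using az by linarith
  then have "hook_at l (beta m a) (m, g)"
    using m ab az lt ge len_m by (auto simp: hook_at_def g b)
  then show ?thesis ..
qed

text \<open>The hand is the last node of row \<open>a\<close>, and its content shifted by the charge
  is \<open>beta m a - 1\<close>.\<close>

lemma hand_hook_at:
  assumes "hook_at l y (m, g)"
  shows "node_residue e (charge l) (hand m g) = (y - 1) mod int e"
proof -
  obtain a where m: "charged_partition m" "charge m = charge l" and a: "1 \<le> a"
    "a \<le> length (parts m)" "g = (int a, 1)" "beta m a = y"
    using hook_atE[OF assms] by metis
  have "Max {v. (int a, v) \<in> rim_hook m g} = int (part m a)"
  proof (rule Max_eqI)
    have sub: "{v. (int a, v) \<in> rim_hook m g} \<subseteq> {1..int (part m a)}"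
      by (auto simp: rim_hook_def young_def)
    then show "finite {v. (int a, v) \<in> rim_hook m g}"
      by (rule finite_subset) simp
    show "v \<le> int (part m a)" if "v \<in> {v. (int a, v) \<in> rim_hook m g}" for v
      using sub that by auto
    show "int (part m a) \<in> {v. (int a, v) \<in> rim_hook m g}"
      using mem_rim_hook[of a "part m a" m a 1] part_pos[OF m(1) a(1,2)]
        part_antimono[OF m(1) a(1), of "Suc a"] a by simp
  qed
  moreover have "int (part m a) - int a + charge l = y - 1"
    using a m by (simp add: beta_def)
  ultimately show ?thesis
    using a by (simp add: hand_def node_residue_def)
qed

text \<open>Row \<open>x\<close> of the hook has \<open>beta m x - beta m (Suc x)\<close> nodes as
  long as it is not the last one. These numbers telescope, and the last row lies in the hook
  entirely.\<close>

lemma card_hook_at: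
  assumes hook: "hook_at l y (m, g)"
  shows "int (card (rim_hook m g)) = y - charge l + int (length (parts l))"
proof -
  obtain a where m: "charged_partition m" "charge m = charge l"
    "length (parts m) = Suc (length (parts l))" and a: "1 \<le> a" "a \<le> length (parts m)"
    "g = (int a, 1)" "beta m a = y"
    using hook_atE[OF hook] by metis
  define h where "h = length (parts m)"
  \<comment> \<open>The bound 1 takes effect in the last row, where \<open>part m (Suc x)\<close> is
    0.\<close>
  define row where "row x = {max 1 (int (part m (Suc x)))..int (part m x)}" for x
  have "rim_hook m g = (\<Union>x\<in>{a..h}. {int x} \<times> row x)"
  proof (intro equalityI subsetI)
    fix p assume p: "p \<in> rim_hook m g"
    then obtain x v where xv: "p = (int x, int v)"
      using rim_hook_subset young_imp_nat by (metis subsetD surj_pair)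
    then have *: "a \<le> x" "1 \<le> v" "v \<le> part m x" "part m (Suc x) \<le> v"
      using p mem_rim_hook[of x v m a 1] a by auto
    then have "x \<le> h"
      using part_eq_0[of m x] by (force simp: h_def)
    then show "p \<in> (\<Union>x\<in>{a..h}. {int x} \<times> row x)"
      using * by (auto simp: xv row_def)
  next
    fix p assume "p \<in> (\<Union>x\<in>{a..h}. {int x} \<times> row x)"
    then obtain x v where xv: "p = (int x, v)" "a \<le> x" "v \<in> row x"
      by auto
    then show "p \<in> rim_hook m g"
      using mem_rim_hook[of x "nat v" m a 1] a by (auto simp: row_def)
  qed
  then have "card (rim_hook m g) = (\<Sum>x = a..h. card ({int x} \<times> row x))"
    by (simp only:) (intro card_UN_disjoint, auto simp: row_def)
  then have "int (card (rim_hook m g)) = (\<Sum>x = a..h. int (card (row x)))"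
    by (simp add: card_cartesian_product_singleton)
  also have "\<dots> = (\<Sum>x = a..<h. int (card (row x))) + int (card (row h))"
    using a by (simp add: h_def sum.last_plus atLeastLessThanSuc_atLeastAtMost[symmetric])
  also have "int (card (row h)) = int (part m h)"
    using a part_pos[OF m(1), of h] by (simp add: row_def h_def part_eq_0)
  also have "(\<Sum>x = a..<h. int (card (row x))) = (\<Sum>x = a..<h. beta m x - beta m (Suc x))"
  proof (rule sum.cong[OF refl])
    fix x assume "x \<in> {a..<h}"
    then show "int (card (row x)) = beta m x - beta m (Suc x)"
      using a part_pos[OF m(1), of "Suc x"] part_antimono[OF m(1), of x "Suc x"]
      by (simp add: row_def beta_def h_def)
  qed
  also have "\<dots> = beta m a - beta m h"
    using sum_Suc_diff'[of a h "\<lambda>x. - beta m x"] a by (simp add: h_def)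
  finally show ?thesis
    using a m by (simp add: beta_def h_def)
qed

section \<open>Removing the first column\<close>

text \<open>The list is non-increasing, so the filter drops zeros only at its end and no remaining
  part changes its index.\<close>

lemma part_remove_first_column:
  assumes "charged_partition m" "1 \<le> k"
  shows "part (remove_first_column m) k = part m k - 1"
proof -
  have *: "(if k \<le> length (filter (\<lambda>k. k \<noteq> 0) (map (\<lambda>k. k - 1) p))
      then filter (\<lambda>k. k \<noteq> 0) (map (\<lambda>k. k - 1) p) ! (k - 1) else 0) =
      (if k \<le> length p then p ! (k - 1) else 0) - 1"
    if "sorted_wrt (\<ge>) p" "1 \<le> k" for p :: "nat list" and k
    using that
  proof (induction p arbitrary: k)
    case (Cons x p)
    show ?case
    proof (cases "x \<le> 1")
      case True
      then have "\<forall>z\<in>set (x # p). z \<le> 1"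
        using Cons.prems by auto
      moreover from this have "filter (\<lambda>k. k \<noteq> 0) (map (\<lambda>k. k - 1) (x # p)) = []"
        by (auto simp: filter_empty_conv)
      moreover have "(x # p) ! (k - 1) \<in> set (x # p)" if "k \<le> length (x # p)"
        using that Cons.prems by (intro nth_mem) auto
      ultimately have "(if k \<le> length (x # p) then (x # p) ! (k - 1) else 0) - 1 = 0"
        by auto
      then show ?thesis
        using \<open>filter _ _ = []\<close> Cons.prems(2) by (simp only: list.size) simp
    next
      case False
      show ?thesis
      proof (cases "k = 1")
        case True
        then show ?thesis
          using False by simp
      next
        case k: False
        then obtain j where "k = Suc j" "1 \<le> j"
          using Cons.prems(2) by (cases k) auto
        then show ?thesis
          using Cons.IH[of j] Cons.prems False by (cases j) auto
      qed
    qed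
  qed simp
  have "sorted_wrt (\<ge>) (parts m)"
    using assms(1) by (simp add: charged_partition_def is_partition_def)
  from *[OF this assms(2)] show ?thesis
    using assms(2) by (simp only: part_def remove_first_column_def fst_conv simp_thms)
qed

lemma charged_partition_remove_first_column:
  assumes "charged_partition m"
  shows "charged_partition (remove_first_column m)"
proof -
  have "sorted_wrt (\<ge>) (map (\<lambda>k. k - 1) (parts m))"
    using assms by (auto simp: charged_partition_def is_partition_def sorted_wrt_map
        elim!: sorted_wrt_mono_rel[rotated])
  then show ?thesis
    by (auto simp: charged_partition_def is_partition_def remove_first_column_def
        intro: sorted_wrt_filter)
qed

text \<open>A nonempty row loses one node while the charge grows by one.\<close>

lemma beta_remove_first_column:
  assumes "charged_partition m" "1 \<le> k" "k \<le> length (parts m)"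
  shows "beta (remove_first_column m) k = beta m k"
  using part_remove_first_column[OF assms(1,2)] part_pos[OF assms]
  by (simp add: beta_def) (simp add: remove_first_column_def)

text \<open>The rows before \<open>a\<close> keep the beads of \<open>l\<close>, row
  \<open>a\<close> carries \<open>y\<close>, and row \<open>Suc x\<close> with
  \<open>x \<ge> a\<close> carries the bead of row \<open>x\<close> of \<open>l\<close>.\<close>

lemma abacus_remove_first_column_hook_at:
  assumes hook: "hook_at l y (m, g)"
  shows "abacus (remove_first_column m) = insert y (abacus l)"
proof -
  let ?r = "remove_first_column m"
  obtain a where m: "charged_partition m" "charge m = charge l"
    and a: "1 \<le> a" "a \<le> length (parts m)" "beta m a = y"
    and lt: "\<And>x. 1 \<le> x \<Longrightarrow> x < a \<Longrightarrow> part m x = part l x"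
    and ge: "\<And>x. a \<le> x \<Longrightarrow> part l x = part m (Suc x) - 1"
    using hook_atE[OF hook] by metis
  have y: "beta ?r a = y"
    using beta_remove_first_column[OF m(1) a(1,2)] a by simp
  have less: "beta ?r x = beta l x" if "1 \<le> x" "x < a" for x
    using beta_remove_first_column[OF m(1), of x] that a lt[of x] m by (simp add: beta_def)
  have greater: "beta ?r (Suc x) = beta l x" if "a \<le> x" for x
    using part_remove_first_column[OF m(1), of "Suc x"] ge[OF that] m
    by (simp add: beta_def) (simp add: remove_first_column_def)
  have "{1..} = {1..<a} \<union> insert a (Suc ` {a..})"
    using a by (auto simp: image_Suc_atLeast_nat)
  moreover have "{1..} = {1..<a} \<union> {a..}"
    using a by auto
  moreover have "beta ?r ` ({1..<a} \<union> insert a (Suc ` {a..})) =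
      insert y (beta l ` ({1..<a} \<union> {a..}))"
    using y less greater by (auto simp: image_Un image_image)
  ultimately show ?thesis
    by (simp add: abacus_eq_beta)
qed

text \<open>Otherwise \<open>remove_first_column m\<close> and \<open>l\<close> would share an
  abacus, although their charges differ by one.\<close>

lemma hook_at_notin_abacus:
  assumes l: "charged_partition l" and hook: "hook_at l y (m, g)"
  shows "y \<notin> abacus l"
proof
  assume "y \<in> abacus l"
  then have "abacus (remove_first_column m) = abacus l"
    using abacus_remove_first_column_hook_at[OF hook] by auto
  moreover have "charged_partition m" "charge m = charge l"
    using hook_atE[OF hook] by metis+
  ultimately have "remove_first_column m = l"
    using abacus_inj[OF charged_partition_remove_first_column l] by blast
  then have "charge l = charge m + 1"
    by (auto simp: remove_first_column_def)
  then show False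
    using \<open>charge m = charge l\<close> by simp
qed

text \<open>Since \<open>m\<close> has one row more than \<open>l\<close>, it is recovered from \<open>remove_first_column m\<close>, whose
  abacus is \<open>insert y (abacus l)\<close>.\<close>

lemma hook_at_unique:
  assumes hook: "hook_at l y (m, g)" and hook': "hook_at l y (m', g')"
  shows "(m, g) = (m', g')"
proof -
  obtain a where m: "charged_partition m" "charge m = charge l"
    "length (parts m) = Suc (length (parts l))" and a: "1 \<le> a" "g = (int a, 1)" "beta m a = y"
    using hook_atE[OF hook] by metis
  obtain a' where m': "charged_partition m'" "charge m' = charge l"
    "length (parts m') = Suc (length (parts l))"
    and a': "1 \<le> a'" "g' = (int a', 1)" "beta m' a' = y"
    using hook_atE[OF hook'] by metis
  have "abacus (remove_first_column m) = abacus (remove_first_column m')"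
    using hook hook' by (simp add: abacus_remove_first_column_hook_at)
  then have r: "remove_first_column m = remove_first_column m'"
    using m m' by (intro abacus_inj charged_partition_remove_first_column)
  have "part m k = part m' k" if "1 \<le> k" for k
  proof (cases "k \<le> length (parts m)")
    case True
    then show ?thesis
      using part_remove_first_column[OF m(1) that] part_remove_first_column[OF m'(1) that] r
        part_pos[OF m(1) that] part_pos[OF m'(1) that] m m' by simp
  qed (simp add: part_eq_0 m m')
  then have "m = m'"
    using m m' by (intro charged_partition_eqI) auto
  \<comment> \<open>Strict decrease of \<open>beta m\<close> allows the value \<open>y\<close> at
    one index only.\<close>
  moreover have "a = a'"
    using beta_strict_antimono[OF m(1) a(1), of a'] beta_strict_antimono[OF m(1) a'(1), of a]
      a a' calculation by (cases a a' rule: linorder_cases) auto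
  ultimately show ?thesis
    using a a' by simp
qed

text \<open>A row with bead \<open>y\<close> is inserted before the first row of \<open>l\<close>
  whose bead is smaller than \<open>y\<close>; the rows of \<open>l\<close> from there on move one
  step down the diagonal.\<close>

lemma hook_at_exists:
  assumes l: "charged_partition l" and y: "y \<notin> abacus l"
  shows "\<exists>h. hook_at l y h"
proof -
  let ?h = "length (parts l)"
  \<comment> \<open>The empty rows of \<open>l\<close> fill all positions up to
    \<open>charge l - int ?h\<close>.\<close>
  have y_ge: "charge l - int ?h < y"
  proof (rule ccontr)
    assume "\<not> ?thesis"
    then have "y = beta l (nat (charge l + 1 - y))" "1 \<le> nat (charge l + 1 - y)"
      by (auto simp: beta_def part_eq_0)
    then show False
      using y unfolding abacus_eq_beta by blast
  qed
  have "beta l (Suc ?h) < y"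
    using y_ge by (simp add: beta_def part_eq_0)
  define a where "a = (LEAST k. 1 \<le> k \<and> beta l k < y)"
  have a: "1 \<le> a" "beta l a < y" "a \<le> Suc ?h"
    using LeastI[of "\<lambda>k. 1 \<le> k \<and> beta l k < y" "Suc ?h"] \<open>beta l (Suc ?h) < y\<close>
      Least_le[of "\<lambda>k. 1 \<le> k \<and> beta l k < y" "Suc ?h"] by (auto simp: a_def)
  have before: "y < beta l k" if "1 \<le> k" "k < a" for k
  proof -
    have "beta l k \<noteq> y"
      using y that by (auto simp: abacus_eq_beta)
    then show ?thesis
      using not_less_Least[of k "\<lambda>k. 1 \<le> k \<and> beta l k < y"] that by (auto simp: a_def)
  qed
  \<comment> \<open>The solution of \<open>beta m a = y\<close> for the row length, at the charge of
    \<open>l\<close>.\<close>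
  define t where "t = nat (y + int a - charge l - 1)"
  have t: "int t = y + int a - charge l - 1" "part l a < t"
    using a by (auto simp: t_def beta_def)
  have t_le: "t \<le> part l k" if "1 \<le> k" "k < a" for k
  proof -
    have "y < beta l (a - 1)"
      using that by (intro before) auto
    then have "t \<le> part l (a - 1)"
      using that t(1) by (simp add: beta_def of_nat_diff)
    moreover have "k \<le> a - 1"
      using that by simp
    ultimately show ?thesis
      using part_antimono[OF l that(1)] order_trans by blast
  qed
  \<comment> \<open>Cutting off after row \<open>Suc ?h\<close> is essential: the empty rows of
    \<open>l\<close> would otherwise each gain a node.\<close>
  define q where "q x = (if x < a then part l x else if x = a then t
    else if x \<le> Suc ?h then Suc (part l (x - 1)) else 0)" for x
  have "q k \<le> q j" if "1 \<le> j" "j \<le> k" for j k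
  proof -
    have "part l (k - 1) \<le> part l i" if "1 \<le> i" "i \<le> k - 1" for i
      using part_antimono[OF l that] .
    moreover have "part l k \<le> part l j"
      using part_antimono[OF l that] .
    ultimately show ?thesis
      using that a t(2) t_le[of j] by (force simp: q_def)
  qed
  moreover have "1 \<le> q k \<longleftrightarrow> k \<le> Suc ?h" if "1 \<le> k" for k
    using that a t(2) part_pos[OF l that] by (auto simp: q_def)
  ultimately obtain m where m: "charged_partition m" "charge m = charge l"
    "length (parts m) = Suc ?h" "\<And>k. 1 \<le> k \<Longrightarrow> part m k = q k"
    using charged_partition_of_fun[of q "Suc ?h" "charge l"] by metis
  have "beta m a = y"
    using a m t by (simp add: beta_def q_def)
  moreover have "part m x = part l x" if "1 \<le> x" "x < a" for x
    using that m by (simp add: q_def)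
  moreover have "part l x = part m (Suc x) - 1" if "a \<le> x" for x
    using that m by (simp add: q_def part_eq_0)
  ultimately have "hook_at l y (m, (int a, 1))"
    using m a by (auto simp: hook_at_def)
  then show ?thesis ..
qed

section \<open>Admissible and smallest hooks\<close>

lemma admissible_hook_iff:
  assumes "charged_partition l"
  shows "admissible_hook e (i - 1) l h \<longleftrightarrow> (\<exists>y. hook_at l y h \<and> y mod int e = i mod int e)"
proof -
  obtain m g where h: "h = (m, g)"
    by (metis surj_pair)
  have "(y - 1) mod int e = (i - 1) mod int e \<longleftrightarrow> y mod int e = i mod int e" for y
    by (simp add: mod_eq_dvd_iff)
  then have "node_residue e (charge l) (hand m g) = (i - 1) mod int e \<longleftrightarrow> y mod int e = i mod int e"
    if "hook_at l y (m, g)" for y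
    using hand_hook_at[OF that] by simp
  then show ?thesis
    using hook_at_adds_rim_hook[OF assms] adds_rim_hook_hook_at[OF assms]
    unfolding h admissible_hook_def prod.case by blast
qed

text \<open>By \<open>card_hook_at\<close> the size is \<open>y\<close> plus a constant depending on
  \<open>l\<close> only, so a smallest hook is one with least \<open>y\<close>;
  \<open>hook_at_exists\<close> ensures that \<open>i\<close> is attained.\<close>

lemma smallest_admissible_hook_iff:
  assumes l: "charged_partition l" and i: "i \<notin> abacus l"
    and least: "\<And>y. y \<notin> abacus l \<Longrightarrow> y mod int e = i mod int e \<Longrightarrow> i \<le> y"
  shows "smallest_admissible_hook e (i - 1) l h \<longleftrightarrow> hook_at l i h"
proof -
  let ?f = "\<lambda>(m, g). card (rim_hook m g)"
  have size: "int (?f h) = y - charge l + int (length (parts l))" if "hook_at l y h" for y h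
    using card_hook_at that by (cases h) auto
  have adm: "admissible_hook e (i - 1) l h \<longleftrightarrow> (\<exists>y. hook_at l y h \<and> y mod int e = i mod int e)" for h
    by (rule admissible_hook_iff[OF l])
  have ge: "i \<le> y" if "hook_at l y h" "y mod int e = i mod int e" for y h
    using least hook_at_notin_abacus[OF l] that by (cases h) auto
  obtain h0 where h0: "hook_at l i h0"
    using hook_at_exists[OF l i] by blast
  show ?thesis
  proof
    assume "smallest_admissible_hook e (i - 1) l h"
    then have h: "admissible_hook e (i - 1) l h" "\<not> ?f h0 < ?f h"
      using h0 adm unfolding smallest_admissible_hook_def is_arg_min_def by blast+
    then obtain y where y: "hook_at l y h" "y mod int e = i mod int e"
      using adm by blast
    have "y = i"
      using ge[OF y] size[OF y(1)] size[OF h0] h(2) by linarith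
    then show "hook_at l i h"
      using y by simp
  next
    assume h: "hook_at l i h"
    have "\<not> ?f h' < ?f h" if h': "admissible_hook e (i - 1) l h'" for h'
    proof -
      obtain y where y: "hook_at l y h'" "y mod int e = i mod int e"
        using h' adm by blast
      then show ?thesis
        using ge[OF y] size[OF y(1)] size[OF h] by linarith
    qed
    moreover have "admissible_hook e (i - 1) l h"
      using h adm by blast
    ultimately show "smallest_admissible_hook e (i - 1) l h"
      unfolding smallest_admissible_hook_def is_arg_min_def by blast
  qed
qed

theorem theorem4p18:
  fixes e :: nat and w :: "int \<Rightarrow> int" and c :: int
  assumes "e \<ge> 2"
    and "w \<in> affine_sym e"
    and "c \<in> {1..int e - 1}"
  shows "is_core e (act w (empty_charged (c - 1))) \<and>
         charge (act w (empty_charged (c - 1))) = c - 1 \<and>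
         is_core e (act w (empty_charged c)) \<and>
         charge (act w (empty_charged c)) = c \<and>
         (\<exists>!h. smallest_admissible_hook e (w c - 1) (act w (empty_charged (c - 1))) h) \<and>
         (\<forall>\<mu> \<gamma>. smallest_admissible_hook e (w c - 1) (act w (empty_charged (c - 1))) (\<mu>, \<gamma>)
            \<longrightarrow> act w (empty_charged c) = remove_first_column \<mu>)"
proof -
  define l where "l = act w (empty_charged (c - 1))"
  have e: "1 \<le> e" and c: "0 \<le> c" "0 \<le> c - 1"
    using assms by auto
  note l = act_empty_charged[OF e assms(2) c(2), folded l_def]
  have inj: "inj w" and surj: "surj w"
    using assms(2) by (auto simp: affine_sym_def bij_def)
  have wc: "w c \<notin> abacus l"
    using inj by (auto simp: l inj_eq)
  \<comment> \<open>A position congruent to \<open>w c\<close> is \<open>w (c + int e * k)\<close>;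
    being a gap, it comes from an argument above \<open>c - 1\<close>, so
    \<open>int e * k \<ge> 0\<close>.\<close>
  have least: "w c \<le> y" if y: "y \<notin> abacus l" "y mod int e = w c mod int e" for y
  proof -
    obtain k where k: "y = w c + int e * k"
      using y(2) by (metis mod_eq_dvd_iff dvdE diff_add_cancel add.commute)
    then have "y = w (c + int e * k)"
      using affine_sym_shift[OF assms(2)] by simp
    then have "c + int e * k \<notin> {..c - 1}"
      using y(1) unfolding l(3) by blast
    then show ?thesis
      using k by simp
  qed
  have iff: "smallest_admissible_hook e (w c - 1) l h \<longleftrightarrow> hook_at l (w c) h" for h
    using smallest_admissible_hook_iff[OF l(1) wc] least by blast
  have "\<exists>!h. hook_at l (w c) h"
    using hook_at_exists[OF l(1) wc] hook_at_unique by (metis surj_pair)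
  moreover have "act w (empty_charged c) = remove_first_column \<mu>" if "hook_at l (w c) (\<mu>, \<gamma>)" for \<mu> \<gamma>
  proof (rule act_eqI)
    show "charged_partition (remove_first_column \<mu>)"
      using that by (meson hook_atE charged_partition_remove_first_column)
    have "{..c} = insert c {..c - 1}"
      by auto
    then show "abacus (remove_first_column \<mu>) = w ` abacus (empty_charged c)"
      using abacus_remove_first_column_hook_at[OF that] by (simp add: abacus_empty_charged l(3))
  qed
  ultimately show ?thesis
    using is_core_act_empty_charged[OF e assms(2)] act_empty_charged(2)[OF e assms(2)] c
    unfolding l_def[symmetric] iff by (auto simp: l_def)
qed

end
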